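(* For every $t \in \mathbb{N}$, prime-length cycles do not have the $\frac{1}{t}$-integral Erd\H{o}s-P\'osa property, even when restricted to planar graphs. That is, for every $t \in \mathbb{N}$ there is no function $f:\mathbb{N}\to\mathbb{N}$ such that for all $k \in \mathbb{N}$ and all planar graphs $G$, either $G$ contains a collection of $k$ cycles of prime length such that every vertex of $G$ lies in at most $t$ of these cycles, or there exists $X \subseteq V(G)$ with $|X| \leq f(k)$ such that $G - X$ has no cycle of prime length.
   Context: $\mathbb{N}$ denotes the set of positive integers. Graphs are finite. The length of a cycle is its number of edges. *)

theory Defs
  imports "HOL-Analysis.Analysis" "HOL-Computational_Algebra.Primes"
begin

record 'a graph =
  verts :: "'a set"
  edges :: "'a set set"

definition simple_graph :: "'a graph \<Rightarrow> bool" where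
  "simple_graph G \<longleftrightarrow> finite (verts G) \<and> (\<forall>e\<in>edges G. e \<subseteq> verts G \<and> card e = 2)"

definition delete_verts :: "'a graph \<Rightarrow> 'a set \<Rightarrow> 'a graph" where
  "delete_verts G X = \<lparr>verts = verts G - X, edges = {e \<in> edges G. e \<inter> X = {}}\<rparr>"

text \<open>A cycle is given by the list of its vertices in cyclic order, without repeating the
  first vertex at the end. Hence its number of edges is the length of the list.\<close>

definition is_cycle :: "'a graph \<Rightarrow> 'a list \<Rightarrow> bool" where
  "is_cycle G c \<longleftrightarrow> 3 \<le> length c \<and> distinct c \<and> set c \<subseteq> verts G \<and>
     (\<forall>i<length c. {c ! i, c ! (Suc i mod length c)} \<in> edges G)"

definition prime_cycle :: "'a graph \<Rightarrow> 'a list \<Rightarrow> bool" where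
  "prime_cycle G c \<longleftrightarrow> is_cycle G c \<and> prime (length c)"

text \<open>In a plane drawing, \<open>p\<close> places the vertices and \<open>\<gamma>\<close> assigns to every edge an arc joining
  its two ends; an arc meets vertices only in its ends, and two arcs meet only in vertices.
  The plane is the type of complex numbers.\<close>

definition plane_drawing ::
  "'a graph \<Rightarrow> ('a \<Rightarrow> complex) \<Rightarrow> ('a set \<Rightarrow> real \<Rightarrow> complex) \<Rightarrow> bool" where
  "plane_drawing G p \<gamma> \<longleftrightarrow>
     inj_on p (verts G) \<and>
     (\<forall>e\<in>edges G. arc (\<gamma> e) \<and> {pathstart (\<gamma> e), pathfinish (\<gamma> e)} = p ` e \<and>
        path_image (\<gamma> e) \<inter> p ` verts G = p ` e) \<and>
     (\<forall>e\<in>edges G. \<forall>e'\<in>edges G. e \<noteq> e' \<longrightarrow>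
        path_image (\<gamma> e) \<inter> path_image (\<gamma> e') \<subseteq> p ` verts G)"

definition planar :: "'a graph \<Rightarrow> bool" where
  "planar G \<longleftrightarrow> (\<exists>p \<gamma>. plane_drawing G p \<gamma>)"

end

(* The theorem is a counting argument on a wide subdivided grid. Let the cycles of a planar graph
   have lengths x + w0 * y + w * z, where y and z count the subdivided edges of two types. By the
   Chinese remainder theorem the weights w and w0 can be chosen such that w0 + w * g + a is prime
   while every small combination with z \<noteq> g * y is divisible by its own prime; choosing the prime
   w0 + w * g + a first makes Dirichlet's theorem unnecessary. The grid has horizontal segments of
   length w0 in row 0 and w in all other rows, and g is more than a third of the number of the
   latter. As every cycle uses a horizontal segment, a prime cycle has z \<ge> g, so 3 * t prime cycles
   use some segment more than t times. On the other hand, if at most s vertices are deleted, a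
   cycle through one segment of row 0 that winds through 2 * s + 2 untouched rows has y = 1 and
   z = g. *)
theory Submission
  imports Defs "HOL-Number_Theory.Cong"
begin

section \<open>Weights with a single prime ratio\<close>

text \<open>Once the sum \<open>w0 + w * g + a\<close> is a fixed prime, \<open>w\<close> is the
  only unknown, and each combination is affine in \<open>w\<close> with slope
  \<open>z - g * y\<close>. A nonzero slope is a unit modulo any large prime, so a single
  \<open>w\<close> can make each of the finitely many bad values a proper multiple of its own
  prime.\<close>

lemma composite_combinations:
  fixes g a N :: nat
  obtains w w0 where "2 \<le> w" "2 \<le> w0" "prime (w0 + w * g + a)"
    "\<And>x y z. \<lbrakk>x \<le> N; y \<le> N; z \<le> N; prime (x + w0 * y + w * z)\<rbrakk> \<Longrightarrow> z = g * y"
proof -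
  define T where "T = {(x, y, z). x \<le> N \<and> y \<le> N \<and> z \<le> N \<and> z \<noteq> g * y}"
  have "T \<subseteq> {..N} \<times> {..N} \<times> {..N}" by (auto simp: T_def)
  then have finT: "finite T" by (rule finite_subset) simp
  \<comment> \<open>\<open>K\<close> bounds the absolute value of \<open>z - g * y\<close> on
    \<open>T\<close>, so no prime above \<open>K\<close> divides this nonzero difference.\<close>
  define K where "K = N + g * N"
  have "infinite ({p :: nat. prime p} - {..K})"
    using primes_infinite by (intro Diff_infinite_finite) auto
  from infinite_arbitrarily_large[OF this] obtain Q where
    Q: "finite Q" "card Q = card T" "Q \<subseteq> {p. prime p} - {..K}" by blast
  obtain p where p: "bij_betw p T Q"
    using finite_same_card_bij[OF finT Q(1)] Q(2) by auto
  have prp: "prime (p b)" "p b > K" if "b \<in> T" for b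
    using bij_betwE[OF p] Q(3) that by (auto simp: not_le)
  have cop: "\<forall>b\<in>T. \<forall>b'\<in>T. b \<noteq> b' \<longrightarrow> coprime (p b) (p b')"
    using prp p by (metis bij_betw_imp_inj_on inj_onD primes_coprime)
  define P where "P = (\<Prod>b\<in>T. p b)"
  have P0: "P > 0" unfolding P_def using prp by (intro prod_pos) (auto simp: prime_gt_0_nat)
  have pP: "p b \<le> P" if "b \<in> T" for b
    unfolding P_def using finT that P0 by (intro dvd_imp_le dvd_prodI) (auto simp: P_def)
  \<comment> \<open>The later choice gives \<open>w \<le> 3 * P\<close> whatever \<open>L\<close>
    is, so this bound leaves \<open>w0 > P + 2\<close>.\<close>
  obtain L where L: "prime L" "L > 3 * P * g + a + P + 2 * g + 2"
    using bigger_prime by blast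
  \<comment> \<open>Substituting \<open>w0 = L - w * g - a\<close>, the combination becomes
    \<open>(L * y + x - a * y) + w * (z - g * y)\<close>.\<close>
  have "\<exists>u. [int u * (int z - int g * int y) = - (int L * y + x - int a * y)] (mod int (p (x, y, z)))"
    if "(x, y, z) \<in> T" for x y z
  proof -
    let ?q = "int (p (x, y, z))" and ?d = "int z - int g * int y"
    have pr: "prime ?q" using prp(1)[OF that] by simp
    have "\<bar>?d\<bar> \<le> int K"
    proof -
      have "g * y \<le> g * N" "z \<le> N" using that by (auto simp: T_def)
      then have "int g * int y \<le> int g * int N" "int z \<le> int N" by (auto simp flip: of_nat_mult)
      moreover have "0 \<le> int g * int y" by simp
      ultimately have "\<bar>?d\<bar> \<le> int N + int g * int N" using \<open>z \<le> N\<close> by linarith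
      then show ?thesis unfolding K_def by simp
    qed
    then have "\<bar>?d\<bar> < ?q" using prp(2)[OF that] by linarith
    moreover have "?d \<noteq> 0" using that by (auto simp: T_def simp flip: of_nat_mult)
    ultimately have "\<not> ?q dvd ?d" using dvd_imp_le_int[of ?d ?q] by linarith
    then have "coprime ?d ?q" using pr by (simp add: prime_imp_coprime coprime_commute)
    then obtain v where v: "[?d * v = 1] (mod ?q)" using cong_solve_coprime_int by blast
    let ?c = "- (int L * y + x - int a * y)"
    have "[int (nat (v * ?c mod ?q)) * ?d = v * ?c * ?d] (mod ?q)"
      using prime_gt_0_int[OF pr] by (simp add: cong_def mod_mult_left_eq)
    moreover have "[v * ?c * ?d = ?c] (mod ?q)"
      using cong_scalar_right[OF v, of ?c] by (simp add: ac_simps)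
    ultimately show ?thesis using cong_trans by blast
  qed
  then have "\<exists>u. [int u * (int (snd (snd b)) - int g * int (fst (snd b))) =
      - (int L * fst (snd b) + fst b - int a * fst (snd b))] (mod int (p b))" if "b \<in> T" for b
    using that by (cases b) auto
  then obtain u where u: "\<And>b. b \<in> T \<Longrightarrow> [int (u b) * (int (snd (snd b)) - int g * int (fst (snd b))) =
      - (int L * fst (snd b) + fst b - int a * fst (snd b))] (mod int (p b))"
    by metis
  obtain w' where w': "\<forall>b\<in>T. [w' = u b] (mod p b)"
    using chinese_remainder_nat[OF finT cop, of u] by blast
  \<comment> \<open>Reduction modulo \<open>P\<close> bounds \<open>w\<close> independently of
    \<open>L\<close>. Adding \<open>2 * P\<close> changes no residue modulo \<open>p b\<close> and
    lifts \<open>w\<close> above \<open>P\<close>.\<close>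
  define w where "w = w' mod P + 2 * P"
  have wu: "[w = u b] (mod p b)" if "b \<in> T" for b
  proof -
    have "p b dvd P" unfolding P_def using finT that by (intro dvd_prodI)
    then have "2 * P mod p b = 0" "w' mod P mod p b = w' mod p b"
      by (simp_all add: mod_mod_cancel)
    then have "[w = w'] (mod p b)"
      unfolding w_def cong_def by (metis mod_add_right_eq add_0_right)
    then show ?thesis using w' that cong_trans by blast
  qed
  have w: "w \<ge> 2 * P" "w \<le> 3 * P" using mod_less_divisor[OF P0, of w'] by (auto simp: w_def intro: less_imp_le)
  have "w * g \<le> 3 * P * g" using w by simp
  define w0 where "w0 = L - w * g - a"
  have Lw: "w0 + w * g + a = L" and w0: "w0 > P + 2"
    unfolding w0_def using L(2) \<open>w * g \<le> 3 * P * g\<close> by linarith+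
  show thesis
  proof
    show "2 \<le> w" using w P0 by linarith
    show "2 \<le> w0" using w0 by simp
    show "prime (w0 + w * g + a)" using Lw L by simp
    fix x y z assume b: "x \<le> N" "y \<le> N" "z \<le> N" and pr: "prime (x + w0 * y + w * z)"
    show "z = g * y"
    proof (rule ccontr)
      assume ne: "z \<noteq> g * y"
      then have T: "(x, y, z) \<in> T" using b by (auto simp: T_def)
      let ?q = "int (p (x, y, z))" and ?d = "int z - int g * int y"
      have "[int w * ?d = int (u (x, y, z)) * ?d] (mod ?q)"
        using wu[OF T] by (intro cong_mult) (auto simp: cong_int_iff)
      also have "[int (u (x, y, z)) * ?d = - (int L * y + x - int a * y)] (mod ?q)"
        using u[OF T] by simp
      finally have "?q dvd int w * ?d + (int L * y + x - int a * y)"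
        by (simp only: cong_iff_dvd_diff diff_minus_eq_add)
      also have "int w * ?d + (int L * y + x - int a * y) = int (x + w0 * y + w * z)"
        by (simp add: Lw[symmetric] algebra_simps)
      finally have "p (x, y, z) dvd x + w0 * y + w * z" by (simp only: of_nat_dvd_iff)
      \<comment> \<open>A prime value would equal its divisor \<open>p (x, y, z)\<close>, which is
        at most \<open>P\<close>; but \<open>y\<close> or \<open>z\<close> is positive and
        contributes a weight above \<open>P\<close>.\<close>
      then have eq: "p (x, y, z) = x + w0 * y + w * z"
        using pr prp(1)[OF T] primes_dvd_imp_eq by blast
      have "y \<noteq> 0 \<or> z \<noteq> 0" using ne by auto
      then have "w0 \<le> w0 * y \<or> w \<le> w * z" by auto
      then have "P < x + w0 * y + w * z" using w w0 P0 by linarith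
      then show False using eq pP[OF T] by simp
    qed
  qed
qed

section \<open>Cycles in a grid with subdivided rows\<close>

definition cycle_edges :: "'a list \<Rightarrow> 'a set set" where
  "cycle_edges c = (\<lambda>i. {c ! i, c ! (Suc i mod length c)}) ` {..<length c}"

text \<open>Different indices could give the same edge only if each were the cyclic successor of the
  other, which needs length 2.\<close>

lemma inj_on_cycle_edges:
  assumes "distinct c" "3 \<le> length c"
  shows "inj_on (\<lambda>i. {c ! i, c ! (Suc i mod length c)}) {..<length c}"
proof (rule inj_onI)
  let ?n = "length c"
  fix i j assume ij: "i \<in> {..<?n}" "j \<in> {..<?n}"
    and "{c ! i, c ! (Suc i mod ?n)} = {c ! j, c ! (Suc j mod ?n)}"
  moreover have "?n > 0" using assms(2) by linarith
  then have "Suc i mod ?n < ?n" "Suc j mod ?n < ?n" by simp_all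
  ultimately have "i = j \<or> i = Suc j mod ?n \<and> j = Suc i mod ?n"
    using nth_eq_iff_index_eq[OF assms(1)] by (auto simp: doubleton_eq_iff)
  then show "i = j" using ij assms(2) by (auto simp: mod_Suc split: if_splits)
qed

lemma card_cycle_edges: "distinct c \<Longrightarrow> 3 \<le> length c \<Longrightarrow> card (cycle_edges c) = length c"
  unfolding cycle_edges_def by (simp add: card_image inj_on_cycle_edges)

text \<open>A cycle has degree 2 at each of its vertices. This forces it to run through whole
  subdivided segments and prevents it from consisting of vertical edges only.\<close>

lemma cycle_edges_other:
  assumes "distinct c" "3 \<le> length c" "e \<in> cycle_edges c" "v \<in> e"
  obtains e' where "e' \<in> cycle_edges c" "e' \<noteq> e" "v \<in> e'"
proof -
  let ?n = "length c"
  let ?E = "\<lambda>i. {c ! i, c ! (Suc i mod ?n)}"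
  obtain j where j: "j < ?n" "e = ?E j" using assms(3) by (auto simp: cycle_edges_def)
  have "\<exists>i<?n. i \<noteq> j \<and> v \<in> ?E i"
  proof (cases "v = c ! j")
    case True
    show ?thesis
    proof (cases "j = 0")
      case True
      \<comment> \<open>The edge before index 0 is the closing edge of the cycle, at index
        \<open>?n - 1\<close>.\<close>
      moreover have "Suc (?n - 1) = ?n" "?n - 1 < ?n" "?n - 1 \<noteq> 0" using assms(2) by linarith+
      ultimately show ?thesis using \<open>v = c ! j\<close> by (intro exI[of _ "?n - 1"]) auto
    next
      case False
      then show ?thesis using \<open>v = c ! j\<close> j by (intro exI[of _ "j - 1"]) auto
    qed
  next
    case False
    then have "v = c ! (Suc j mod ?n)" using assms(4) j by auto
    then show ?thesis using j assms(2) by (intro exI[of _ "Suc j mod ?n"]) (auto simp: mod_Suc)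
  qed
  then obtain i where i: "i < ?n" "i \<noteq> j" "v \<in> ?E i" by blast
  moreover have "?E i \<noteq> ?E j" using inj_on_cycle_edges[OF assms(1,2)] i j by (auto dest: inj_onD)
  ultimately show thesis using that[of "?E i"] j by (auto simp: cycle_edges_def)
qed

lemma cycle_edges_subset:
  assumes "is_cycle G c" shows "cycle_edges c \<subseteq> edges G"
  using assms by (auto simp: is_cycle_def cycle_edges_def)

lemma cycle_edges_verts: "\<lbrakk>e \<in> cycle_edges c; v \<in> e\<rbrakk> \<Longrightarrow> v \<in> set c"
  by (cases "c = []") (auto simp: cycle_edges_def)

lemma set_cycle_in_edge:
  assumes "v \<in> set c" obtains e where "e \<in> cycle_edges c" "v \<in> e"
  using assms by (auto simp: cycle_edges_def in_set_conv_nth)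

section \<open>The subdivided grid and the lengths of its cycles\<close>

definition hedge :: "nat \<Rightarrow> nat \<Rightarrow> (nat \<times> nat) set" where
  "hedge r y = {(r, y), (r, Suc y)}"

text \<open>Each of the rows \<open>0..B\<close> consists of \<open>m\<close> segments, those of row
  \<open>r\<close> having \<open>W r\<close> edges. Vertices are numbered by unit steps along their
  row, so column \<open>i\<close> meets row \<open>r\<close> in \<open>(r, W r * i)\<close>;
  vertical edges end only in such points.\<close>

locale subdivided_grid =
  fixes B m :: nat and W :: "nat \<Rightarrow> nat"
  assumes W: "\<And>r. 2 \<le> W r"
begin

definition vedge :: "nat \<Rightarrow> nat \<Rightarrow> (nat \<times> nat) set" where
  "vedge r c = {(r, W r * c), (Suc r, W (Suc r) * c)}"

definition grid :: "(nat \<times> nat) graph" where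
  "grid = \<lparr>verts = {(r, y). r \<le> B \<and> y \<le> W r * m},
     edges = {hedge r y |r y. r \<le> B \<and> y < W r * m} \<union> {vedge r c |r c. r < B \<and> c \<le> m}\<rparr>"

lemma W_pos [simp]: "0 < W r" using W[of r] by simp

lemma W_nonzero [simp]: "W r \<noteq> 0" using W[of r] by simp

lemma hedge_iff [simp]: "hedge r y = hedge r' y' \<longleftrightarrow> r = r' \<and> y = y'"
  by (auto simp: hedge_def doubleton_eq_iff)

lemma vedge_iff [simp]: "vedge r c = vedge r' c' \<longleftrightarrow> r = r' \<and> c = c'"
  by (auto simp: vedge_def doubleton_eq_iff)

lemma hedge_neq_vedge [simp]: "hedge r y \<noteq> vedge r' c" "vedge r' c \<noteq> hedge r y"
  by (auto simp: hedge_def vedge_def doubleton_eq_iff)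

lemma hedge_in_grid [simp]: "hedge r y \<in> edges grid \<longleftrightarrow> r \<le> B \<and> y < W r * m"
  by (auto simp: grid_def)

lemma vedge_in_grid [simp]: "vedge r c \<in> edges grid \<longleftrightarrow> r < B \<and> c \<le> m"
  by (auto simp: grid_def)

lemma edges_grid_cases:
  assumes "e \<in> edges grid"
  obtains r y where "e = hedge r y" "r \<le> B" "y < W r * m"
    | r c where "e = vedge r c" "r < B" "c \<le> m"
  using assms by (auto simp: grid_def)

lemma simple_graph_grid: "simple_graph grid"
proof -
  have "verts grid \<subseteq> (SIGMA r:{..B}. {..W r * m})" by (auto simp: grid_def)
  then have "finite (verts grid)" by (rule finite_subset) auto
  then show ?thesis
    by (auto simp: simple_graph_def grid_def hedge_def vedge_def)
qed

text \<open>Inner vertices of a subdivided segment have degree 2, so a cycle contains the segment as soon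
  as it contains its first edge.\<close>

definition segments :: "(nat \<times> nat) list \<Rightarrow> nat \<Rightarrow> nat set" where
  "segments c r = {i. i < m \<and> hedge r (W r * i) \<in> cycle_edges c}"

definition vertical_edges :: "(nat \<times> nat) list \<Rightarrow> (nat \<times> nat) set" where
  "vertical_edges c = {(r, i). r < B \<and> i \<le> m \<and> vedge r i \<in> cycle_edges c}"

context
  fixes c assumes c: "is_cycle grid c"
begin

lemma cycle_distinct_length: "distinct c" "3 \<le> length c" using c by (auto simp: is_cycle_def)

text \<open>The vertex \<open>(r, Suc y)\<close> lies on no column, so these are the only grid edges
  that can meet it, and a cycle through it needs both.\<close>

lemma hedge_Suc_iff:
  assumes "\<not> W r dvd Suc y"
  shows "hedge r y \<in> cycle_edges c \<longleftrightarrow> hedge r (Suc y) \<in> cycle_edges c"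
proof -
  have *: "e = hedge r y \<or> e = hedge r (Suc y)" if "e \<in> cycle_edges c" "(r, Suc y) \<in> e" for e
    using subsetD[OF cycle_edges_subset[OF c] that(1)]
    by (cases rule: edges_grid_cases) (use that assms in \<open>auto simp: hedge_def vedge_def\<close>)
  have v: "(r, Suc y) \<in> hedge r y" "(r, Suc y) \<in> hedge r (Suc y)" by (auto simp: hedge_def)
  show ?thesis
    using * cycle_edges_other[OF cycle_distinct_length _ v(1)] cycle_edges_other[OF cycle_distinct_length _ v(2)] by metis
qed

lemma hedge_segment:
  "k < W r \<Longrightarrow> hedge r (W r * i + k) \<in> cycle_edges c \<longleftrightarrow> hedge r (W r * i) \<in> cycle_edges c"
proof (induction k)
  case (Suc k)
  have "\<not> W r dvd Suc (W r * i + k)"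
    using Suc.prems dvd_imp_le[of "W r" "Suc k"] by (auto simp flip: add_Suc_right simp: dvd_add_right_iff)
  from hedge_Suc_iff[OF this] Suc show ?case by simp
qed simp

text \<open>This yields the form \<open>x + w0 * y + w * z\<close> of cycle lengths:
  \<open>x\<close> counts vertical edges, while horizontal edges come in full segments.\<close>

lemma length_cycle:
  "length c = card (vertical_edges c) + (\<Sum>r\<le>B. W r * card (segments c r))"
proof -
  let ?H = "SIGMA r:{..B}. {y. y < W r * m \<and> hedge r y \<in> cycle_edges c}"
  have finV: "finite (vertical_edges c)"
    by (rule finite_subset[of _ "{..B} \<times> {..m}"]) (auto simp: vertical_edges_def)
  have finH: "finite ?H" by auto
  have eq: "cycle_edges c = (\<lambda>(r, y). hedge r y) ` ?H \<union> (\<lambda>(r, i). vedge r i) ` vertical_edges c"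
    (is "_ = ?A \<union> ?V")
    using cycle_edges_subset[OF c] by (auto simp: vertical_edges_def elim!: edges_grid_cases)
  have "length c = card (?A \<union> ?V)" using card_cycle_edges[OF cycle_distinct_length] eq by simp
  also have "\<dots> = card ?A + card ?V"
    by (rule card_Un_disjoint) (use finV finH in auto)
  also have "card ?V = card (vertical_edges c)" by (rule card_image) (auto simp: inj_on_def)
  also have "card ?A = card ?H" by (rule card_image) (auto simp: inj_on_def)
  also have "card ?H = (\<Sum>r\<le>B. card {y. y < W r * m \<and> hedge r y \<in> cycle_edges c})" by simp
  also have "\<dots> = (\<Sum>r\<le>B. W r * card (segments c r))"
  proof (rule sum.cong)
    fix r
    let ?P = "\<lambda>y. of_bool (hedge r y \<in> cycle_edges c) :: nat"
    have "card {y. y < W r * m \<and> hedge r y \<in> cycle_edges c} = sum ?P {..<m * W r}"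
      by (simp add: mult.commute Collect_conj_eq lessThan_def)
    \<comment> \<open>The row is split into blocks of \<open>W r\<close> consecutive edges, one
      block per segment; by \<open>hedge_segment\<close> the indicator is constant on each.\<close>
    also have "\<dots> = (\<Sum>i<m. sum ?P {i * W r..<i * W r + W r})" by (rule sum.nat_group[symmetric])
    also have "\<dots> = (\<Sum>i<m. W r * ?P (W r * i))"
    proof (rule sum.cong)
      fix i
      have "sum ?P {i * W r..<i * W r + W r} = (\<Sum>k=0..<W r. ?P (k + i * W r))"
        using sum.shift_bounds_nat_ivl[of ?P 0 "i * W r" "W r"] by (simp add: add.commute)
      also have "\<dots> = (\<Sum>k=0..<W r. ?P (W r * i))"
        by (rule sum.cong) (use hedge_segment in \<open>auto simp: add.commute mult.commute\<close>)
      finally show "sum ?P {i * W r..<i * W r + W r} = W r * ?P (W r * i)" by simp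
    qed simp
    also have "\<dots> = W r * card (segments c r)"
      by (simp add: segments_def Collect_conj_eq lessThan_def flip: sum_distrib_left)
    finally show "card {y. y < W r * m \<and> hedge r y \<in> cycle_edges c} = W r * card (segments c r)" .
  qed simp
  finally show ?thesis by simp
qed

text \<open>Consider a vertex of the cycle with maximal row index. If all edges were vertical, both
  cycle edges there would lead to the preceding row, but only one grid edge does.\<close>

lemma segments_nonempty: "\<exists>r\<le>B. segments c r \<noteq> {}"
proof -
  have ne: "set c \<noteq> {}" using cycle_distinct_length by auto
  have "Max (fst ` set c) \<in> fst ` set c" using ne by (intro Max_in) auto
  then obtain v where v: "v \<in> set c" "fst v = Max (fst ` set c)" by auto
  then have max: "fst u \<le> fst v" if "u \<in> set c" for u using that by (simp add: Max_ge)
  obtain e where e: "e \<in> cycle_edges c" "v \<in> e" using set_cycle_in_edge[OF v(1)] .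
  obtain e' where e': "e' \<in> cycle_edges c" "e' \<noteq> e" "v \<in> e'" using cycle_edges_other[OF cycle_distinct_length e] .
  have "\<exists>r y. hedge r y \<in> cycle_edges c"
  proof (rule ccontr)
    assume no: "\<not> ?thesis"
    have *: "\<exists>r i. f = vedge r i \<and> v = (Suc r, W (Suc r) * i)" if "f \<in> cycle_edges c" "v \<in> f" for f
      using subsetD[OF cycle_edges_subset[OF c] that(1)]
    proof (cases rule: edges_grid_cases)
      case (2 r i)
      then have "(Suc r, W (Suc r) * i) \<in> set c" 
        using that cycle_edges_verts[of f] by (auto simp: vedge_def)
      then have "Suc r \<le> fst v" using max by fastforce
      then show ?thesis using 2 that by (auto simp: vedge_def)
    qed (use no that in auto)
    from *[OF e] *[OF e'(1,3)] e'(2) show False by auto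
  qed
  then obtain r y where ry: "hedge r y \<in> cycle_edges c" by blast
  then have b: "r \<le> B" "y < W r * m" using cycle_edges_subset[OF c] by auto
  \<comment> \<open>The edge lies in segment \<open>y div W r\<close>, whose first edge therefore
    also belongs to the cycle.\<close>
  have "hedge r (W r * (y div W r)) \<in> cycle_edges c"
    using hedge_segment[of "y mod W r" r "y div W r"] ry by simp
  moreover have "y div W r < m" using b by (simp add: less_mult_imp_div_less mult.commute)
  ultimately show ?thesis using b by (auto simp: segments_def)
qed

end

end

section \<open>Planarity\<close>

text \<open>Edges are drawn as straight segments. Writing a segment as a convex hull needs no order
  of the two ends, so all conditions concern point sets only.\<close>

lemma planar_straight_line:
  fixes p :: "'a \<Rightarrow> complex"
  assumes G: "simple_graph G" and inj: "inj_on p (verts G)"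
    and vertex: "\<And>e. e \<in> edges G \<Longrightarrow> convex hull (p ` e) \<inter> p ` verts G \<subseteq> p ` e"
    and cross: "\<And>e e'. \<lbrakk>e \<in> edges G; e' \<in> edges G; e \<noteq> e'\<rbrakk> \<Longrightarrow>
      convex hull (p ` e) \<inter> convex hull (p ` e') \<subseteq> p ` verts G"
  shows "planar G"
proof -
  have "\<exists>g. arc g \<and> {pathstart g, pathfinish g} = p ` e \<and> path_image g = convex hull (p ` e)"
    if e: "e \<in> edges G" for e
  proof -
    obtain u v where uv: "e = {u, v}" "u \<noteq> v" "u \<in> verts G" "v \<in> verts G"
      using G e by (auto simp: simple_graph_def card_2_iff)
    then have "p u \<noteq> p v" using inj by (auto dest: inj_onD)
    then show ?thesis using uv
      by (intro exI[of _ "linepath (p u) (p v)"]) (auto simp: segment_convex_hull)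
  qed
  then obtain \<gamma> where \<gamma>: "\<And>e. e \<in> edges G \<Longrightarrow> arc (\<gamma> e) \<and>
      {pathstart (\<gamma> e), pathfinish (\<gamma> e)} = p ` e \<and> path_image (\<gamma> e) = convex hull (p ` e)"
    by metis
  have "p ` e \<subseteq> convex hull (p ` e) \<inter> p ` verts G" if "e \<in> edges G" for e
    using G that hull_subset[of "p ` e" convex] by (auto simp: simple_graph_def)
  then have "plane_drawing G p \<gamma>"
    unfolding plane_drawing_def using inj \<gamma> vertex cross by (simp add: subset_antisym)
  then show ?thesis by (auto simp: planar_def)
qed

section \<open>A straight-line drawing of the grid\<close>

context subdivided_grid
begin

text \<open>Dividing by \<open>W r\<close> gives all segments width 1 and aligns column
  \<open>c\<close> on the line with real part \<open>c\<close>, so vertical edges are drawn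
  vertically although the rows have different subdivisions.\<close>

definition pos :: "nat \<times> nat \<Rightarrow> complex" where
  "pos = (\<lambda>(r, y). Complex (real y / real (W r)) (real r))"

lemma inj_pos: "inj_on pos A"
  by (auto simp: inj_on_def pos_def)

lemma hull_hedge:
  "z \<in> convex hull (pos ` hedge r y) \<longleftrightarrow>
    Im z = real r \<and> real y \<le> Re z * real (W r) \<and> Re z * real (W r) \<le> real (Suc y)"
proof -
  have "real y / real (W r) \<le> real (Suc y) / real (W r)" by (simp add: divide_right_mono)
  moreover have "real (W r) > 0" by simp
  ultimately show ?thesis
    by (auto simp: hedge_def pos_def closed_segment_same_Im closed_segment_eq_real_ivl
        pos_divide_le_eq pos_le_divide_eq simp flip: segment_convex_hull)
qed

lemma hull_vedge:
  "z \<in> convex hull (pos ` vedge r c) \<longleftrightarrow>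
    Re z = real c \<and> real r \<le> Im z \<and> Im z \<le> real (Suc r)"
  by (auto simp: vedge_def pos_def closed_segment_same_Re closed_segment_eq_real_ivl
      simp flip: segment_convex_hull)

lemma pos_in_hull:
  assumes "e \<in> edges grid" "pos v \<in> convex hull (pos ` e)"
  shows "v \<in> e"
proof (cases v)
  case (Pair s x)
  from assms(1) show ?thesis
  proof (cases rule: edges_grid_cases)
    case (1 r y)
    then show ?thesis using assms(2) Pair
      by (auto simp: hull_hedge) (auto simp: pos_def hedge_def)
  next
    case (2 r c)
    then have "real x / real (W s) = real c" "r \<le> s" "s \<le> Suc r"
      using assms(2) Pair hull_vedge[of "pos (s, x)" r c] by (auto simp: pos_def)
    moreover from this(1) have "real x = real (W s * c)" by (simp add: field_simps)
    then have "x = W s * c" by (simp only: of_nat_eq_iff)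
    ultimately show ?thesis using 2 Pair by (auto simp: vedge_def le_Suc_eq)
  qed
qed

lemma hulls_meet_in_vertex:
  assumes e: "e \<in> edges grid" "e' \<in> edges grid" "e \<noteq> e'"
    and z: "z \<in> convex hull (pos ` e)" "z \<in> convex hull (pos ` e')"
  shows "z \<in> pos ` verts grid"
proof -
  have lattice: "z \<in> pos ` verts grid" 
    if "Im z = real r" "Re z * real (W r) = real y" "r \<le> B" "y \<le> W r * m" for r y
  proof
    show "z = pos (r, y)" using that by (auto simp: pos_def complex_eq_iff field_simps)
    show "(r, y) \<in> verts grid" using that by (simp add: grid_def)
  qed
  \<comment> \<open>A horizontal edge of row \<open>r\<close> and a vertical edge of column
    \<open>c\<close> can meet only at the crossing \<open>(r, W r * c)\<close>.\<close>
  have hv: "z \<in> pos ` verts grid"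
    if "hedge r y \<in> edges grid" "vedge s c \<in> edges grid"
      "z \<in> convex hull (pos ` hedge r y)" "z \<in> convex hull (pos ` vedge s c)" for r y s c
  proof (rule lattice[of r "W r * c"])
    show "Re z * real (W r) = real (W r * c)" using that by (simp add: hull_vedge)
  qed (use that in \<open>auto simp: hull_hedge\<close>)
  from e(1) show ?thesis
  proof (cases rule: edges_grid_cases)
    case e1: (1 r y)
    from e(2) show ?thesis
    proof (cases rule: edges_grid_cases)
      case e2: (1 s x)
      have "r = s" using z e1 e2 by (auto simp: hull_hedge)
      then have "y \<noteq> x" using e e1 e2 by auto
      \<comment> \<open>Two different intervals of length 1 with integral ends meet at most in the
        larger of their left ends.\<close>
      have "Re z * real (W r) = real (max x y)"
        using z e1 e2 \<open>r = s\<close> \<open>y \<noteq> x\<close> unfolding max_def by (auto simp: hull_hedge)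
      then show ?thesis using z e1 e2 \<open>r = s\<close> by (intro lattice[of r "max x y"]) (auto simp: hull_hedge)
    next
      case (2 s c)
      then show ?thesis using hv[of r y s c] e z e1 by simp
    qed
  next
    case e1: (2 r c)
    from e(2) show ?thesis
    proof (cases rule: edges_grid_cases)
      case (1 s y)
      then show ?thesis using hv[of s y r c] e z e1 by simp
    next
      case e2: (2 s d)
      have "c = d" using z e1 e2 by (auto simp: hull_vedge)
      then have "r \<noteq> s" using e e1 e2 by auto
      have "Im z = real (max r s)"
        using z e1 e2 \<open>c = d\<close> \<open>r \<noteq> s\<close> unfolding max_def by (auto simp: hull_vedge)
      then show ?thesis using z e1 e2 \<open>c = d\<close>
        by (intro lattice[of "max r s" "W (max r s) * c"]) (auto simp: hull_vedge)
    qed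
  qed
qed

lemma planar_grid: "planar grid"
proof (rule planar_straight_line[OF simple_graph_grid inj_pos])
  fix e assume e: "e \<in> edges grid"
  then show "convex hull (pos ` e) \<inter> pos ` verts grid \<subseteq> pos ` e"
    using pos_in_hull by blast
qed (use hulls_meet_in_vertex in blast)

end

section \<open>Serpentine cycles\<close>

lemma is_cycle_delete_verts:
  assumes "3 \<le> length c" "distinct c" "set c \<subseteq> verts G" "set c \<inter> X = {}"
    and "successively (\<lambda>u v. {u, v} \<in> edges G) c" "{last c, hd c} \<in> edges G"
  shows "is_cycle (delete_verts G X) c"
proof -
  have "{c ! i, c ! (Suc i mod length c)} \<in> edges G" if "i < length c" for i
  proof (cases "Suc i < length c")
    case True
    then show ?thesis using assms(5) by (simp add: successively_conv_nth)
  next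
    case False
    then have "Suc i = length c" "c \<noteq> []" using that by auto
    then have "c ! i = last c" "c ! (Suc i mod length c) = hd c"
      using last_conv_nth[of c] by (simp_all add: hd_conv_nth flip: \<open>Suc i = length c\<close>)
    then show ?thesis using assms(6) by simp
  qed
  moreover have "c ! i \<notin> X \<and> c ! (Suc i mod length c) \<notin> X" if "i < length c" for i
  proof -
    have "Suc i mod length c < length c" using that by (intro mod_less_divisor) linarith
    then show ?thesis using assms(4) that nth_mem by blast
  qed
  ultimately show ?thesis using assms by (auto simp: is_cycle_def delete_verts_def)
qed

lemma successively_map_upt:
  assumes "\<And>i. \<lbrakk>a \<le> i; Suc i < b\<rbrakk> \<Longrightarrow> P (f i) (f (Suc i))"
  shows "successively P (map f [a..<b])"
  using assms by (simp add: successively_conv_nth)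

section \<open>Paths along rows and columns\<close>

context subdivided_grid
begin

abbreviation adj :: "nat \<times> nat \<Rightarrow> nat \<times> nat \<Rightarrow> bool" where
  "adj u v \<equiv> {u, v} \<in> edges grid"

lemma adj_row [simp]: "adj (r, y) (r, Suc y) \<longleftrightarrow> r \<le> B \<and> y < W r * m"
  using hedge_in_grid[of r y] by (simp add: hedge_def)

lemma adj_row_pred: "0 < y \<Longrightarrow> adj (r, y - 1) (r, y) \<longleftrightarrow> r \<le> B \<and> y \<le> W r * m"
  by (cases y) (auto simp: Suc_le_eq)

lemma adj_col [simp]: "adj (r, W r * i) (Suc r, W (Suc r) * i) \<longleftrightarrow> r < B \<and> i \<le> m"
  using vedge_in_grid[of r i] by (simp add: vedge_def)

text \<open>The half-open range omits the last corner, with which the next piece starts;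
  concatenated pieces thus share no vertex.\<close>

definition col_path :: "nat \<Rightarrow> nat \<Rightarrow> nat \<Rightarrow> (nat \<times> nat) list" where
  "col_path i r s = map (\<lambda>r. (r, W r * i)) [r..<s]"

definition row_path :: "nat \<Rightarrow> nat \<Rightarrow> nat \<Rightarrow> (nat \<times> nat) list" where
  "row_path r x y = map (\<lambda>y. (r, y)) [x..<y]"

lemma successively_col: "\<lbrakk>s \<le> Suc B; i \<le> m\<rbrakk> \<Longrightarrow> successively adj (col_path i r s)"
  unfolding col_path_def by (rule successively_map_upt) simp

lemma successively_row: "\<lbrakk>r \<le> B; y \<le> Suc (W r * m)\<rbrakk> \<Longrightarrow> successively adj (row_path r x y)"
  unfolding row_path_def by (rule successively_map_upt) simp

lemma successively_rev_adj: "successively adj (rev xs) = successively adj xs"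
  by (simp add: insert_commute)

lemma distinct_row_col [simp]: "distinct (row_path r x y)" "distinct (col_path i r s)"
  by (auto simp: row_path_def col_path_def distinct_map inj_on_def)

lemma set_row [simp]: "set (row_path r x y) = {(r, z) |z. x \<le> z \<and> z < y}"
  and set_col [simp]: "set (col_path i a b) = {(r, W r * i) |r. a \<le> r \<and> r < b}"
  by (auto simp: row_path_def col_path_def)

lemma length_row_col [simp]: "length (row_path r x y) = y - x" "length (col_path i a b) = b - a"
  by (auto simp: row_path_def col_path_def)

lemma row_ends: "x < y \<Longrightarrow> row_path r x y \<noteq> [] \<and> hd (row_path r x y) = (r, x) \<and> last (row_path r x y) = (r, y - 1)"
  by (auto simp: row_path_def hd_map last_map hd_upt last_upt)

lemma col_ends: "a < b \<Longrightarrow> col_path i a b \<noteq> [] \<and> hd (col_path i a b) = (a, W a * i) \<and>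
    last (col_path i a b) = (b - 1, W (b - 1) * i)"
  by (auto simp: col_path_def hd_map last_map hd_upt last_upt)

text \<open>Two rows of \<open>F\<close> at a time: along column \<open>i\<close> to the first,
  across to column \<open>j\<close>, on to the second and back to column \<open>i\<close>. An even
  number of rows therefore ends in column \<open>i\<close>. The conditions on the vertices serve to
  keep pieces disjoint; in particular the path meets its starting row only in its first vertex,
  which leaves the rest of that row to the preceding piece.\<close>

lemma serpentine:
  assumes "i < j" "j \<le> m" "F \<subseteq> {a<..<B}" "card F = 2 * q" "a \<le> B"
  shows "\<exists>xs. successively adj xs \<and> distinct xs \<and> xs \<noteq> [] \<and> hd xs = (a, W a * i) \<and>
    last xs = (B, W B * i) \<and> length xs = Suc (B - a) + (\<Sum>r\<in>F. W r) * (j - i) \<and>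
    (\<forall>(r, y)\<in>set xs. a \<le> r \<and> r \<le> B \<and> (r = a \<longrightarrow> y = W a * i) \<and> W r * i \<le> y \<and> y \<le> W r * j \<and>
      (r \<in> F \<or> y = W r * i \<or> y = W r * j))"
  using assms(3-5)
proof (induction q arbitrary: F a)
  case 0
  then have "F = {}" using finite_subset[of F "{a<..<B}"] by simp
  then show ?case using 0 assms(1,2) col_ends[of a "Suc B" i]
    by (intro exI[of _ "col_path i a (Suc B)"]) (auto intro!: successively_col)
next
  case (Suc q)
  have finF: "finite F" using Suc.prems(1) finite_subset by blast
  define r1 where "r1 = Min F"
  have "F \<noteq> {}" using Suc.prems by auto
  then have r1: "r1 \<in> F" "\<And>r. r \<in> F \<Longrightarrow> r1 \<le> r" using finF by (auto simp: r1_def)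
  define r2 where "r2 = Min (F - {r1})"
  have "card (F - {r1}) = Suc (2 * q)" using r1 Suc.prems finF by simp
  then have "F - {r1} \<noteq> {}" by (metis card.empty nat.distinct(1))
  then have "r2 \<in> F - {r1}" "\<And>r. r \<in> F - {r1} \<Longrightarrow> r2 \<le> r"
    using finF Min_in[of "F - {r1}"] by (auto simp: r2_def)
  then have r2: "r2 \<in> F" "r1 < r2" "\<And>r. r \<in> F \<Longrightarrow> r \<noteq> r1 \<Longrightarrow> r2 \<le> r"
    using r1 by (auto simp: order_less_le)
  have b: "a < r1" "r2 < B" using r1 r2 Suc.prems(1) by auto
  \<comment> \<open>The rows of \<open>F\<close> beyond \<open>r2\<close> are left to the induction
    hypothesis, started at row \<open>r2\<close>.\<close>
  define F' where "F' = F - {r1, r2}"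
  have "F' \<subseteq> {r2<..<B}" using r2 Suc.prems(1) by (force simp: F'_def order_less_le)
  moreover have "card F' = 2 * q" using r1 r2 Suc.prems(2) finF by (simp add: F'_def card_Diff_subset)
  ultimately obtain xs where xs: "successively adj xs" "distinct xs" "xs \<noteq> []"
    "hd xs = (r2, W r2 * i)" "last xs = (B, W B * i)"
    "length xs = Suc (B - r2) + (\<Sum>r\<in>F'. W r) * (j - i)"
    and xs': "\<forall>(r, y)\<in>set xs. r2 \<le> r \<and> r \<le> B \<and> (r = r2 \<longrightarrow> y = W r2 * i) \<and> W r * i \<le> y \<and> y \<le> W r * j \<and>
      (r \<in> F' \<or> y = W r * i \<or> y = W r * j)"
    using Suc.IH[of F' r2] b by auto
  have F: "(\<Sum>r\<in>F. W r) = W r1 + W r2 + (\<Sum>r\<in>F'. W r)"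
  proof -
    have "F = insert r1 (insert r2 F')" "r1 \<notin> insert r2 F'" "r2 \<notin> F'" "finite F'"
      using finF r1(1) r2(1,2) by (auto simp: F'_def)
    then show ?thesis by (metis add.assoc finite_insert sum.insert)
  qed
  have lt: "W r * i < W r * j" for r using assms(1) by simp
  have le: "W r * j \<le> W r * m" "W r * i \<le> W r * m" for r using assms by simp_all
  \<comment> \<open>The four pieces in order of traversal. The shift by \<open>Suc\<close> in
    \<open>?A4\<close> leaves the corner \<open>(r2, W r2 * i)\<close> to \<open>xs\<close>.\<close>
  let ?A1 = "col_path i a r1" and ?A2 = "row_path r1 (W r1 * i) (W r1 * j)" and ?A3 = "col_path j r1 r2"
    and ?A4 = "rev (row_path r2 (Suc (W r2 * i)) (Suc (W r2 * j)))"
  note ends = col_ends[OF b(1), of i] row_ends[OF lt, of r1 r1] col_ends[OF r2(2), of j]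
    row_ends[of "Suc (W r2 * i)" "Suc (W r2 * j)" r2]
  have S: "successively adj ?A1" "successively adj ?A2" "successively adj ?A3" "successively adj ?A4"
    unfolding successively_rev_adj
    by (intro successively_col successively_row; use b r2(2) assms(1,2) le[of r1] le[of r2] in linarith)+
  have J1: "adj (last ?A1) (hd ?A2)"
    using adj_col[of "r1 - 1" i] ends b r2 assms(1,2) by simp
  have J2: "adj (last ?A2) (hd ?A3)"
    using adj_row_pred[of "W r1 * j" r1] ends b r2 lt[of r1] le[of r1] assms(1,2) by simp
  have J3: "adj (last ?A3) (hd ?A4)"
    using adj_col[of "r2 - 1" j] ends b r2 assms(1,2) by (simp add: hd_rev)
  have J4: "adj (last ?A4) (hd xs)"
    using adj_row[of r2 "W r2 * i"] ends b r2 lt[of r2] le[of r2] xs(4)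
    by (simp add: last_rev insert_commute)
  let ?L = "?A1 @ ?A2 @ ?A3 @ ?A4 @ xs"
  have ne: "?A1 \<noteq> []" "?A2 \<noteq> []" "?A3 \<noteq> []" "?A4 \<noteq> []" using ends lt[of r2] by auto
  have "successively adj ?L"
    using S J1 J2 J3 J4 xs(1,3) ne by (simp only: successively_append_iff hd_append) simp
  moreover have "distinct ?L"
    using xs(2) xs' b r2 lt by (fastforce simp: distinct_append)
  moreover have "hd ?L = (a, W a * i)" using ends(1) by simp
  moreover have "last ?L = (B, W B * i)" using xs by simp
  moreover have "length ?L = Suc (B - a) + (\<Sum>r\<in>F. W r) * (j - i)"
    using xs(6) b r2 by (simp add: F algebra_simps diff_mult_distrib2)
  moreover have "\<forall>(r, y)\<in>set ?L. a \<le> r \<and> r \<le> B \<and> (r = a \<longrightarrow> y = W a * i) \<and> W r * i \<le> y \<and> y \<le> W r * j \<and>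
      (r \<in> F \<or> y = W r * i \<or> y = W r * j)"
  proof -
    have "\<forall>(r, y)\<in>set xs. a \<le> r \<and> r \<le> B \<and> (r = a \<longrightarrow> y = W a * i) \<and> W r * i \<le> y \<and> y \<le> W r * j \<and>
      (r \<in> F \<or> y = W r * i \<or> y = W r * j)"
      using xs' b r2(2) by (fastforce simp: F'_def)
    moreover have "W r * i \<le> W r * j" for r using assms(1) by simp
    ultimately show ?thesis using b r1(1) r2(1,2) by auto
  qed
  moreover have "?L \<noteq> []" using ne by simp
  ultimately show ?case by blast
qed

text \<open>These are the places that a serpentine cycle may visit outside the rows in
  \<open>F\<close>: three columns and the two segments that close the cycle in rows \<open>0\<close>
  and \<open>B\<close>.\<close>

definition frame :: "nat \<Rightarrow> nat \<Rightarrow> (nat \<times> nat) set" where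
  "frame i j = {(r, y). y \<in> {W r * i, W r * Suc i, W r * j}
     \<or> r \<in> {0, B} \<and> W r * i \<le> y \<and> y \<le> W r * Suc i}"

text \<open>A serpentine path between columns \<open>Suc i\<close> and \<open>j\<close> is closed
  through column \<open>i\<close>. Its ends lie in rows \<open>0\<close> and \<open>B\<close>, so
  exactly one segment of each of these rows is used; both long columns together account for
  \<open>2 * B\<close>.\<close>

lemma serpentine_cycle:
  assumes "Suc i < j" "j \<le> m" "F \<subseteq> {0<..<B}" "even (card F)" "0 < B"
    and X: "X \<inter> frame i j = {}" "X \<inter> F \<times> UNIV = {}"
  shows "\<exists>c. is_cycle (delete_verts grid X) c \<and>
    length c = 2 * B + W 0 + W B + (\<Sum>r\<in>F. W r) * (j - Suc i)"
proof -
  obtain q where q: "card F = 2 * q" using assms(4) by blast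
  obtain xs where xs: "successively adj xs" "distinct xs" "xs \<noteq> []"
    "hd xs = (0, W 0 * Suc i)" "last xs = (B, W B * Suc i)"
    "length xs = Suc B + (\<Sum>r\<in>F. W r) * (j - Suc i)"
    and xs': "\<forall>(r, y)\<in>set xs. r \<le> B \<and> W r * Suc i \<le> y \<and> y \<le> W r * j \<and>
      (r \<in> F \<or> y = W r * Suc i \<or> y = W r * j)"
    using serpentine[OF assms(1-3) q] by fastforce
  \<comment> \<open>As \<open>W r\<close> is at least 2, a segment has an inner vertex, so the
    closing pieces \<open>?A2\<close> and \<open>?A4\<close> are nonempty.\<close>
  have lt: "Suc (W r * i) < W r * Suc i" for r using W[of r] by simp
  have le: "W r * Suc i \<le> W r * m" "W r * i \<le> W r * m" "W r * j \<le> W r * m" for r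
    using assms by (simp_all only: mult_le_mono2)
  let ?A1 = "rev (col_path i 0 (Suc B))" and ?A2 = "row_path 0 (Suc (W 0 * i)) (W 0 * Suc i)"
    and ?A4 = "rev (row_path B (Suc (W B * i)) (W B * Suc i))"
  note ends = col_ends[of 0 "Suc B" i] row_ends[OF lt, of 0 0] row_ends[OF lt, of B B]
  let ?L = "?A1 @ ?A2 @ xs @ ?A4"
  have ne: "?A1 \<noteq> []" "?A2 \<noteq> []" "?A4 \<noteq> []" using ends by auto
  have S: "successively adj ?A1" "successively adj ?A2" "successively adj ?A4"
    unfolding successively_rev_adj
    by (intro successively_col successively_row; use assms(1,2) le[of 0] le[of B] in linarith)+
  have J1: "adj (last ?A1) (hd ?A2)"
    using adj_row[of 0 "W 0 * i"] ends lt[of 0] le[of 0] assms(1,2) by (simp add: last_rev)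
  have J2: "adj (last ?A2) (hd xs)"
    using adj_row_pred[of "W 0 * Suc i" 0] ends lt[of 0] le[of 0] xs(4) by simp
  have J3: "adj (last xs) (hd ?A4)"
    using adj_row_pred[of "W B * Suc i" B] ends lt[of B] le[of B] xs(5) by (simp add: hd_rev insert_commute)
  have "adj (last ?A4) (hd ?A1)"
    using adj_row[of B "W B * i"] ends lt[of B] le[of B] assms(1,2) by (simp add: last_rev hd_rev insert_commute)
  then have J4: "adj (last ?L) (hd ?L)" using ne by simp
  have "successively adj ?L"
    using S J1 J2 J3 xs(1,3) ne by (simp only: successively_append_iff hd_append) simp
  moreover have "distinct ?L"
    using xs(2) xs' lt assms(5) by (fastforce simp: distinct_append)
  moreover have "set ?L \<subseteq> verts grid"
  proof -
    have "set xs \<subseteq> verts grid" using xs' le order_trans by (fastforce simp: grid_def)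
    then show ?thesis using le[of 0] le[of B] le(2) by (auto simp: grid_def)
  qed
  moreover have "set ?L \<subseteq> frame i j \<union> F \<times> UNIV"
    using xs' lt by (fastforce simp: frame_def)
  then have "set ?L \<inter> X = {}" using X by blast
  moreover have len: "length ?L = 2 * B + W 0 + W B + (\<Sum>r\<in>F. W r) * (j - Suc i)"
    using xs(6) W[of 0] W[of B] by simp
  moreover from this have "3 \<le> length ?L" using W[of 0] W[of B] by linarith
  ultimately have "is_cycle (delete_verts grid X) ?L" using J4 by (intro is_cycle_delete_verts)
  then show ?thesis using len by blast
qed

end

section \<open>Packing and covering\<close>

definition map_graph :: "('a \<Rightarrow> 'b) \<Rightarrow> 'a graph \<Rightarrow> 'b graph" where
  "map_graph f G = \<lparr>verts = f ` verts G, edges = (`) f ` edges G\<rparr>"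

lemma verts_map_graph [simp]: "verts (map_graph f G) = f ` verts G"
  and edges_map_graph [simp]: "edges (map_graph f G) = (`) f ` edges G"
  by (simp_all add: map_graph_def)

lemma simple_graph_map:
  assumes "inj f" "simple_graph G" shows "simple_graph (map_graph f G)"
  using assms by (auto simp: simple_graph_def card_image[OF inj_on_subset[OF assms(1)]])

lemma planar_map:
  assumes "inj f" "planar G" shows "planar (map_graph f G)"
proof -
  obtain p \<gamma> where "plane_drawing G p \<gamma>" using assms(2) by (auto simp: planar_def)
  moreover have "(\<lambda>x. p (inv f x)) ` f ` A = p ` A" for A
    using assms(1) by (simp add: image_image)
  moreover have "inv f ` f ` e = e" for e using assms(1) by (simp add: image_image)
  ultimately have "plane_drawing (map_graph f G) (\<lambda>x. p (inv f x)) (\<lambda>e. \<gamma> (inv f ` e))"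
    using assms(1) by (simp add: plane_drawing_def inj_on_def inj_image_eq_iff, metis)
  then show ?thesis by (auto simp: planar_def)
qed

lemma is_cycle_map:
  assumes "inj f" shows "is_cycle (map_graph f G) (map f c) \<longleftrightarrow> is_cycle G c"
proof -
  have "{f u, f v} \<in> (`) f ` E \<longleftrightarrow> {u, v} \<in> E" for u v E
    using inj_image_eq_iff[OF assms, of "{u, v}"] by (auto simp: image_iff)
  moreover have "Suc i mod length c < length c" if "i < length c" for i
    using that by (intro mod_less_divisor) linarith
  moreover have "f ` set c \<subseteq> f ` verts G \<longleftrightarrow> set c \<subseteq> verts G"
    using assms by (simp add: inj_image_subset_iff)
  ultimately show ?thesis
    using assms by (simp add: is_cycle_def distinct_map inj_on_subset[OF assms])
qed

lemma delete_verts_map: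
  assumes "inj f" shows "delete_verts (map_graph f G) (f ` X) = map_graph f (delete_verts G X)"
proof -
  have "f ` e \<inter> f ` X = {} \<longleftrightarrow> e \<inter> X = {}" for e
    using assms by (simp flip: image_Int)
  then show ?thesis using assms by (auto simp: delete_verts_def map_graph_def image_set_diff)
qed

section \<open>Bounds for packings, and cycles avoiding a small vertex set\<close>

context subdivided_grid
begin

lemma segments_subset: "segments c r \<subseteq> {..<m}"
  by (auto simp: segments_def)

text \<open>Double counting of pairs of a cycle and a segment in rows \<open>1..B\<close>: there are
  \<open>B * m\<close> such segments, and each lies on at most \<open>t\<close> cycles.\<close>

lemma packing_bound:
  assumes "\<And>i. i < k \<Longrightarrow> g \<le> (\<Sum>r=1..B. card (segments (C i) r))"
    and t: "\<And>v. v \<in> verts grid \<Longrightarrow> card {i. i < k \<and> v \<in> set (C i)} \<le> t"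
  shows "k * g \<le> t * (B * m)"
proof -
  have "k * g \<le> (\<Sum>i<k. \<Sum>r=1..B. card (segments (C i) r))"
    using sum_mono[of "{..<k}" "\<lambda>_. g"] assms(1) by simp
  also have "\<dots> = (\<Sum>i<k. \<Sum>r=1..B. \<Sum>n<m. of_bool (n \<in> segments (C i) r))"
    by (simp add: segments_def Collect_conj_eq lessThan_def)
  also have "\<dots> = (\<Sum>r=1..B. \<Sum>i<k. \<Sum>n<m. of_bool (n \<in> segments (C i) r))"
    by (rule sum.swap)
  also have "\<dots> = (\<Sum>r=1..B. \<Sum>n<m. \<Sum>i<k. of_bool (n \<in> segments (C i) r))"
    by (intro sum.cong refl sum.swap)
  also have "\<dots> \<le> (\<Sum>r=1..B. \<Sum>n<m. t)"
  proof (intro sum_mono)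
    fix r n assume rn: "r \<in> {1..B}" "n \<in> {..<m}"
    have "(\<Sum>i<k. of_bool (n \<in> segments (C i) r)) = card {i. i < k \<and> n \<in> segments (C i) r}"
      by (simp add: Collect_conj_eq lessThan_def)
    \<comment> \<open>Cycles sharing a segment share its left end, so the bound on vertices
      applies.\<close>
    also have "\<dots> \<le> card {i. i < k \<and> (r, W r * n) \<in> set (C i)}"
      by (intro card_mono) (auto simp: segments_def hedge_def intro: cycle_edges_verts)
    also have "\<dots> \<le> t" using rn by (intro t) (auto simp: grid_def)
    finally show "(\<Sum>i<k. of_bool (n \<in> segments (C i) r)) \<le> t" .
  qed
  finally show ?thesis by (simp add: ac_simps)
qed

lemma frame_cases:
  assumes "(r, y) \<in> frame i j"
  shows "W r * i \<le> y \<and> y \<le> W r * Suc i \<or> y = W r * j"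
  using assms by (auto simp: frame_def)

text \<open>In terms of columns, a frame lies in the strip from \<open>i\<close> to
  \<open>Suc i\<close> and on the line \<open>j\<close>; the inequalities separate these for the two
  frames, whatever the row.\<close>

lemma frames_disjoint:
  assumes "Suc i < i'" "Suc i' < j" "j < j'"
  shows "frame i j \<inter> frame i' j' = {}"
proof -
  have le: "a \<le> b" if "W r * a \<le> y" "y \<le> W r * b" for a b r y
    using order_trans[OF that] by simp
  have False if "(r, y) \<in> frame i j" "(r, y) \<in> frame i' j'" for r y
    using frame_cases[OF that(1)] frame_cases[OF that(2)] le[of r i' y "Suc i"] le[of r j' y "Suc i"]
      le[of r j y "Suc i'"] le[of r j' y j] assms by auto
  then show ?thesis by auto
qed

text \<open>Pigeonhole principle for \<open>s + 1\<close> disjoint frames: their strips share out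
  the columns \<open>0\<close> to \<open>2 * s + 1\<close>, and their third columns are the even
  ones from \<open>2 * s + 2\<close> to \<open>4 * s + 2\<close>.\<close>

lemma frame_avoiding:
  assumes "finite X" "card X \<le> s"
  shows "\<exists>l\<le>s. X \<inter> frame (2 * l) (2 * l + 2 * s + 2) = {}"
proof (rule ccontr)
  let ?F = "\<lambda>l. frame (2 * l) (2 * l + 2 * s + 2)"
  assume "\<not> ?thesis"
  then have "\<forall>l. \<exists>v. l \<le> s \<longrightarrow> v \<in> X \<inter> ?F l" by blast
  then obtain v where v: "\<And>l. l \<le> s \<Longrightarrow> v l \<in> X \<inter> ?F l" by metis
  have disj: "?F l \<inter> ?F l' = {}" if "l < l'" "l' \<le> s" for l l'
    by (rule frames_disjoint) (use that in auto)
  have "v l \<noteq> v l'" if "l < l'" "l' \<le> s" for l l'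
    using disj[OF that] v[of l] v[of l'] that by auto
  then have "inj_on v {..s}" by (intro linorder_inj_onI) auto
  then have "card {..s} \<le> card X"
    by (rule card_inj_on_le) (use v assms in auto)
  then show False using assms by simp
qed

text \<open>Of the \<open>3 * s + 2\<close> inner rows at least \<open>2 * s + 2\<close> avoid
  \<open>X\<close>. The cycle crosses \<open>2 * s + 1\<close> segments in each of
  \<open>2 * s + 2\<close> such rows; the summand \<open>1\<close> is its segment in row
  \<open>B\<close>.\<close>

lemma cycle_avoiding:
  assumes "finite X" "card X \<le> s" and m: "m = 4 * s + 2" and B: "B = 3 * s + 3"
    and W': "\<And>r. 0 < r \<Longrightarrow> W r = w"
  shows "\<exists>c. is_cycle (delete_verts grid X) c \<and>
    length c = W 0 + w * (1 + (2 * s + 2) * (2 * s + 1)) + 2 * B"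
proof -
  obtain l where l: "l \<le> s" "X \<inter> frame (2 * l) (2 * l + 2 * s + 2) = {}"
    using frame_avoiding[OF assms(1,2)] by blast
  have "card {0<..<B} - card (fst ` X) \<le> card ({0<..<B} - fst ` X)"
    using assms(1) by (intro diff_card_le_card_Diff) auto
  moreover have "card (fst ` X) \<le> s" using card_image_le[OF assms(1), of fst] assms(2) by linarith
  ultimately have "2 * s + 2 \<le> card ({0<..<B} - fst ` X)" by (simp add: B)
  then obtain F where F: "F \<subseteq> {0<..<B} - fst ` X" "card F = 2 * s + 2"
    by (rule obtain_subset_with_card_n) blast
  have "(\<Sum>r\<in>F. W r) = (2 * s + 2) * w"
    using F W' by (subst sum.cong[of F F W "\<lambda>_. w"]) auto
  moreover have "\<exists>c. is_cycle (delete_verts grid X) c \<and> length c =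
      2 * B + W 0 + W B + (\<Sum>r\<in>F. W r) * (2 * l + 2 * s + 2 - Suc (2 * l))"
    by (rule serpentine_cycle) (use F l in \<open>force simp: m B\<close>)+
  ultimately show ?thesis using W'[of B] by (auto simp: B algebra_simps)
qed

end

text \<open>One graph defeats the bound \<open>s\<close> on the covering side, while already
  \<open>3 * t\<close> prime cycles are too many on the packing side.\<close>

lemma graph_without_erdos_posa:
  fixes s t :: nat
  assumes "1 \<le> t"
  obtains G :: "(nat \<times> nat) graph" where "simple_graph G" "planar G"
    "\<And>C. \<lbrakk>\<And>i. i < 3 * t \<Longrightarrow> prime_cycle G (C i);
      \<And>v. v \<in> verts G \<Longrightarrow> card {i. i < 3 * t \<and> v \<in> set (C i)} \<le> t\<rbrakk> \<Longrightarrow> False"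
    "\<And>X. \<lbrakk>X \<subseteq> verts G; card X \<le> s\<rbrakk> \<Longrightarrow> \<exists>c. prime_cycle (delete_verts G X) c"
proof -
  define B m g where "B = 3 * s + 3" and "m = 4 * s + 2" and "g = 1 + (2 * s + 2) * (2 * s + 1)"
  \<comment> \<open>\<open>N\<close> bounds all three counts at once: vertical edges by
    \<open>B * (m + 1)\<close>, segments of row 0 by \<open>m\<close>, other segments by
    \<open>B * m\<close>.\<close>
  define N where "N = B * (m + 1) + m"
  \<comment> \<open>The offset \<open>2 * B\<close> is the number of vertical edges of the cycle
    from \<open>cycle_avoiding\<close>.\<close>
  obtain w w0 where w: "2 \<le> w" "2 \<le> w0" and pr: "prime (w0 + w * g + 2 * B)"
    and comp: "\<And>x y z. \<lbrakk>x \<le> N; y \<le> N; z \<le> N; prime (x + w0 * y + w * z)\<rbrakk> \<Longrightarrow> z = g * y"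
    using composite_combinations[of g "2 * B" N] by metis
  interpret subdivided_grid B m "\<lambda>r. if r = 0 then w0 else w"
    by unfold_locales (use w in auto)
  have long: "g \<le> (\<Sum>r=1..B. card (segments c r))" if "prime_cycle grid c" for c
  proof -
    let ?x = "card (vertical_edges c)" and ?y = "card (segments c 0)"
      and ?z = "\<Sum>r=1..B. card (segments c r)"
    have c: "is_cycle grid c" "prime (length c)" using that by (auto simp: prime_cycle_def)
    have seg: "card (segments c r) \<le> m" for r
      using card_mono[OF finite_lessThan segments_subset] by simp
    have "?x \<le> card ({..<B} \<times> {..m})"
      by (intro card_mono) (auto simp: vertical_edges_def)
    then have x: "?x \<le> N" by (simp add: N_def)
    have y: "?y \<le> N" using seg[of 0] by (simp add: N_def)
    have "?z \<le> B * m" using sum_bounded_above[of "{1..B}" "\<lambda>r. card (segments c r)" m] seg by simp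
    then have z: "?z \<le> N" by (simp add: N_def)
    have split: "{..B} = insert 0 {1..B}" by auto
    have "length c = ?x + w0 * ?y + w * ?z"
      using length_cycle[OF c(1)] by (simp add: split sum_distrib_left)
    then have eq: "?z = g * ?y" using comp[OF x y z] c(2) by simp
    \<comment> \<open>A cycle avoiding row 0 would have \<open>?z = g * 0\<close>, hence no
      horizontal segment at all.\<close>
    moreover have "?y \<noteq> 0"
    proof
      assume "?y = 0"
      then have "?z = 0" using eq by simp
      have fin: "finite (segments c r)" for r using segments_subset finite_subset by blast
      have "segments c r = {}" if "r \<le> B" for r
        using \<open>?y = 0\<close> \<open>?z = 0\<close> that fin by (cases "r = 0") auto
      then show False using segments_nonempty[OF c(1)] by blast
    qed
    ultimately show ?thesis by (cases ?y) auto
  qed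
  show thesis
  proof
    show "simple_graph grid" "planar grid" by (rule simple_graph_grid planar_grid)+
  next
    fix C assume C: "\<And>i. i < 3 * t \<Longrightarrow> prime_cycle grid (C i)"
      "\<And>v. v \<in> verts grid \<Longrightarrow> card {i. i < 3 * t \<and> v \<in> set (C i)} \<le> t"
    have "3 * t * g \<le> t * (B * m)"
      by (rule packing_bound[of "3 * t" g C t]) (use C long in auto)
    \<comment> \<open>In fact \<open>B * m = 3 * (2 * s + 2) * (2 * s + 1)\<close>, which is
      \<open>3 * g - 3\<close>.\<close>
    moreover have "B * m < 3 * g" by (simp add: B_def m_def g_def algebra_simps)
    then have "t * (B * m) < t * (3 * g)" using assms by simp
    ultimately show False by (simp add: mult.left_commute mult.commute)
  next
    fix X assume X: "X \<subseteq> verts grid" "card X \<le> s"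
    then have "finite X" using simple_graph_grid finite_subset by (auto simp: simple_graph_def)
    from cycle_avoiding[OF this X(2) m_def B_def, of w] pr
    show "\<exists>c. prime_cycle (delete_verts grid X) c"
      by (auto simp: prime_cycle_def g_def)
  qed
qed

theorem theorem1p2:
  fixes t :: nat
  assumes "1 \<le> t"
  shows "\<not> (\<exists>f :: nat \<Rightarrow> nat. f \<in> {1..} \<rightarrow> {1..} \<and>
    (\<forall>k\<ge>1. \<forall>G :: nat graph. simple_graph G \<and> planar G \<longrightarrow>
      (\<exists>C. (\<forall>i<k. prime_cycle G (C i)) \<and>
           (\<forall>v\<in>verts G. card {i. i < k \<and> v \<in> set (C i)} \<le> t)) \<or>
      (\<exists>X \<subseteq> verts G. card X \<le> f k \<and> \<not> (\<exists>c. prime_cycle (delete_verts G X) c))))"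
proof
  assume "\<exists>f :: nat \<Rightarrow> nat. f \<in> {1..} \<rightarrow> {1..} \<and>
    (\<forall>k\<ge>1. \<forall>G :: nat graph. simple_graph G \<and> planar G \<longrightarrow>
      (\<exists>C. (\<forall>i<k. prime_cycle G (C i)) \<and>
           (\<forall>v\<in>verts G. card {i. i < k \<and> v \<in> set (C i)} \<le> t)) \<or>
      (\<exists>X \<subseteq> verts G. card X \<le> f k \<and> \<not> (\<exists>c. prime_cycle (delete_verts G X) c)))"
  then obtain f :: "nat \<Rightarrow> nat" where f: "\<And>k (G :: nat graph). \<lbrakk>1 \<le> k; simple_graph G; planar G\<rbrakk> \<Longrightarrow>
      (\<exists>C. (\<forall>i<k. prime_cycle G (C i)) \<and>
           (\<forall>v\<in>verts G. card {i. i < k \<and> v \<in> set (C i)} \<le> t)) \<or>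
      (\<exists>X \<subseteq> verts G. card X \<le> f k \<and> \<not> (\<exists>c. prime_cycle (delete_verts G X) c))"
    by blast
  \<comment> \<open>The function \<open>f\<close> is refuted at \<open>k = 3 * t\<close>, with a
    graph built for \<open>s = f (3 * t)\<close>.\<close>
  obtain G :: "(nat \<times> nat) graph" where G: "simple_graph G" "planar G"
    and pack: "\<And>C. \<lbrakk>\<And>i. i < 3 * t \<Longrightarrow> prime_cycle G (C i);
      \<And>v. v \<in> verts G \<Longrightarrow> card {i. i < 3 * t \<and> v \<in> set (C i)} \<le> t\<rbrakk> \<Longrightarrow> False"
    and hit: "\<And>X. \<lbrakk>X \<subseteq> verts G; card X \<le> f (3 * t)\<rbrakk> \<Longrightarrow> \<exists>c. prime_cycle (delete_verts G X) c"
    by (rule graph_without_erdos_posa[OF assms, of "f (3 * t)"]) blast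
  \<comment> \<open>The grid has pairs as vertices; encoding them as numbers gives a graph on
    \<open>nat\<close>.\<close>
  let ?G = "map_graph prod_encode G"
  have inj: "inj prod_encode" by (rule inj_prod_encode)
  have pc: "prime_cycle (map_graph prod_encode H) (map prod_encode c) \<longleftrightarrow> prime_cycle H c" for H c
    by (simp add: prime_cycle_def is_cycle_map[OF inj])
  have "1 \<le> 3 * t" using assms by simp
  from f[OF this simple_graph_map[OF inj G(1)] planar_map[OF inj G(2)]]
  show False
  proof (elim disjE exE conjE)
    fix C assume C: "\<forall>i<3 * t. prime_cycle ?G (C i)"
      "\<forall>v\<in>verts ?G. card {i. i < 3 * t \<and> v \<in> set (C i)} \<le> t"
    have "map prod_encode (map prod_decode (C i)) = C i" for i by (simp add: comp_def)
    then have "prime_cycle G (map prod_decode (C i))" if "i < 3 * t" for i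
      using C(1) that pc[of G "map prod_decode (C i)"] by simp
    moreover have "v \<in> set (map prod_decode (C i)) \<longleftrightarrow> prod_encode v \<in> set (C i)" for v i
      by (force simp: image_iff)
    then have "card {i. i < 3 * t \<and> v \<in> set (map prod_decode (C i))} \<le> t" if "v \<in> verts G" for v
      using C(2) that by simp
    ultimately show False by (rule pack)
  next
    fix X assume X: "X \<subseteq> verts ?G" "card X \<le> f (3 * t)"
      "\<not> (\<exists>c. prime_cycle (delete_verts ?G X) c)"
    obtain Y where Y: "Y \<subseteq> verts G" "X = prod_encode ` Y" using X(1) by (auto simp: subset_image_iff)
    then have "card Y \<le> f (3 * t)" using X(2) card_image[OF inj_on_subset[OF inj]] by (metis subset_UNIV)
    then obtain c where "prime_cycle (delete_verts G Y) c" using hit[OF Y(1)] by blast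
    then show False using X(3) pc[of "delete_verts G Y" c] delete_verts_map[OF inj, of G Y] Y(2) by auto
  qed
qed

end
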